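(* Let $m>1$ be an integer and let $f$ be a polynomial of degree at most $2$ over $\mathbb{Z}_m$ in $n$ variables, viewed as a function $f:B^n\to\mathbb{Z}_m$. For each prime power $q$ with $q\,\|\, m$, let $r_q$ be the boolean rank of $f$ modulo $q$, and let $r=\sum_{q\|m} r_q$. Suppose $f(\mathbf x)=0$ has a solution $\mathbf x\in B^n$. Then: (1) if $n\ge m r\log m$, then $f(\mathbf x)=0$ has at least $2$ solutions in $B^n$; (2) $f(\mathbf x)=0$ has at least $2^{\,n-mr\log m\log n}$ solutions in $B^n$.
   Context: $B=\{0,1\}\subseteq\mathbb{Z}$. For a prime power $q=p^a$, $q\,\|\,m$ means $p^a\mid m$ but $p^{a+1}\nmid m$. For a modulus $q$ and a polynomial $f$ over $\mathbb{Z}_m$ with $q\mid m$, the boolean rank of $f$ modulo $q$ is the minimal $r$ such that there exist a function $F:\mathbb{Z}_q^r\to\mathbb{Z}_q$ and vectors $\mathbf v_1,\ldots,\mathbf v_r\in\mathbb{Z}_q^n$ with $f(\mathbf x)\equiv F(\mathbf v_1^T\mathbf x,\ldots,\mathbf v_r^T\mathbf x)\pmod q$ for all $\mathbf x\in B^n$.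
   Formalization: Logarithms are to base 2; part (1) is stated for n ≥ 1 (it fails for n = 0, f = 0) and part (2) for n ≥ 2 (it fails for n = 1, m = 2, f = x₁, where log n = 0, and log n is undefined for n = 0). *)

theory Defs
  imports Complex_Main "HOL-Library.Poly_Mapping" "HOL-Library.FuncSet"
    "HOL-Number_Theory.Cong" "HOL-Computational_Algebra.Primes"
begin

text \<open>
  Residue classes modulo \<open>m\<close> are represented by the integers \<open>0, \<dots>, m - 1\<close>.
  A polynomial in the variables \<open>X\<^sub>0, X\<^sub>1, \<dots>\<close> is a finitely supported map from exponent
  vectors (finitely supported maps from variable indices to exponents) to coefficients.
\<close>

type_synonym mpolynomial = "(nat \<Rightarrow>\<^sub>0 nat) \<Rightarrow>\<^sub>0 int"

definition polys_mod :: "nat \<Rightarrow> nat \<Rightarrow> mpolynomial set" where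
  "polys_mod m n = {f. (\<forall>e. Poly_Mapping.lookup f e \<in> {0..<int m}) \<and>
                       (\<forall>e\<in>Poly_Mapping.keys f. Poly_Mapping.keys e \<subseteq> {..<n})}"

definition degree_at_most :: "nat \<Rightarrow> mpolynomial \<Rightarrow> bool" where
  "degree_at_most d f \<longleftrightarrow>
     (\<forall>e\<in>Poly_Mapping.keys f. (\<Sum>i\<in>Poly_Mapping.keys e. Poly_Mapping.lookup e i) \<le> d)"

definition eval_poly :: "mpolynomial \<Rightarrow> (nat \<Rightarrow> int) \<Rightarrow> int" where
  "eval_poly f x = (\<Sum>e\<in>Poly_Mapping.keys f. Poly_Mapping.lookup f e *
                     (\<Prod>i\<in>Poly_Mapping.keys e. x i ^ Poly_Mapping.lookup e i))"

definition bool_cube :: "nat \<Rightarrow> (nat \<Rightarrow> int) set" where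
  "bool_cube n = {..<n} \<rightarrow>\<^sub>E {0, 1}"

text \<open>
  An element of \<open>\<int>\<^sub>q\<^sup>r\<close> is passed to \<open>F\<close> as the list of the canonical representatives of its
  \<open>r\<close> entries, so that any \<open>F\<close> on integer lists induces a map \<open>\<int>\<^sub>q\<^sup>r \<rightarrow> \<int>\<^sub>q\<close>, and every such
  map arises in this way.
\<close>

definition boolean_rank :: "nat \<Rightarrow> nat \<Rightarrow> mpolynomial \<Rightarrow> nat" where
  "boolean_rank q n f =
     (LEAST r. \<exists>(F :: int list \<Rightarrow> int) (v :: nat \<Rightarrow> nat \<Rightarrow> int).
        \<forall>x\<in>bool_cube n.
          [eval_poly f x = F (map (\<lambda>j. (\<Sum>i<n. v j i * x i) mod int q) [0..<r])] (mod int q))"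

definition exact_prime_powers :: "nat \<Rightarrow> nat set" where
  "exact_prime_powers m =
     {q. \<exists>p a. prime p \<and> a \<ge> 1 \<and> q = p ^ a \<and> p ^ a dvd m \<and> \<not> p ^ (a + 1) dvd m}"

definition bool_solutions :: "nat \<Rightarrow> nat \<Rightarrow> mpolynomial \<Rightarrow> (nat \<Rightarrow> int) set" where
  "bool_solutions m n f = {x \<in> bool_cube n. [eval_poly f x = 0] (mod int m)}"

end

theory Submission imports Defs "HOL-Library.Real_Mod" begin

text \<open>
  Modulo each \<open>q\<close>, the value of \<open>f\<close> is determined by \<open>r\<^sub>q\<close> linear forms, so every Boolean point on
  which all \<open>r\<close> forms agree with their values at the given solution is again a solution.
  If only the empty subset of \<open>I\<close> could be flipped without changing the forms modulo \<open>m\<close>, then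
  \<open>\<Sum>\<chi>. \<Prod>i\<in>I. (1 - \<chi> g\<^sub>i / \<alpha>\<^sub>i)\<close>, summed over the characters \<open>\<chi>\<close> of \<open>\<int>\<^sub>m\<^sup>r\<close>, would equal \<open>m\<^sup>r\<close> for
  all nonzero \<open>\<alpha>\<^sub>i\<close>, where \<open>g\<^sub>i\<close> is the change in the forms caused by flipping \<open>x\<^sub>i\<close>. But if
  \<open>card I \<ge> m r ln m\<close>, roots of unity \<open>\<alpha>\<^sub>i\<close> chosen greedily make every summand vanish.
  Consequently a solution of the linear system closest to any prescribed point is at Hamming
  distance at most \<open>m r ln m\<close> from it, and the second bound follows by counting Hamming balls.
\<close>

section \<open>Additive characters modulo \<open>m\<close> and their orthogonality\<close>

definition unity_root :: "nat \<Rightarrow> int \<Rightarrow> complex" where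
  "unity_root m t = cis (2 * pi * of_int t / of_nat m)"

lemma unity_root_0 [simp]: "unity_root m 0 = 1"
  by (simp add: unity_root_def)

lemma unity_root_add: "unity_root m (s + t) = unity_root m s * unity_root m t"
  by (simp add: unity_root_def cis_mult add_divide_distrib distrib_left)

lemma unity_root_sum:
  "unity_root m (\<Sum>i\<in>A. g i) = (\<Prod>i\<in>A. unity_root m (g i))"
  by (induction A rule: infinite_finite_induct) (simp_all add: unity_root_add)

lemma unity_root_of_nat_mult: "unity_root m (int k * t) = unity_root m t ^ k"
  by (induction k) (simp_all add: unity_root_add distrib_right)

lemma unity_root_eq_1_iff:
  assumes "m > 0"
  shows "unity_root m t = 1 \<longleftrightarrow> int m dvd t"
proof -
  have "unity_root m t = 1 \<longleftrightarrow> (\<exists>k. 2 * pi * of_int t / of_nat m = of_int k * (2 * pi))"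
    unfolding unity_root_def by (rule cis_eq_1_iff)
  also have "\<dots> \<longleftrightarrow> (\<exists>k. real_of_int t = real_of_int (int m * k))"
    using assms by (simp add: field_simps)
  also have "\<dots> \<longleftrightarrow> int m dvd t"
    unfolding of_int_eq_iff dvd_def ..
  finally show ?thesis .
qed

text \<open>\<open>unity_root m s\<close> is an \<open>m\<close>-th root of unity, so the geometric
  sum of its powers vanishes unless it equals 1.\<close>

lemma sum_unity_root:
  assumes "m > 0"
  shows "(\<Sum>k<m. unity_root m (int k * s)) = (if int m dvd s then of_nat m else 0)"
proof -
  have "unity_root m s ^ m = 1"
    using unity_root_eq_1_iff[OF assms, of "int m * s"]
    by (simp flip: unity_root_of_nat_mult)
  then show ?thesis
    using unity_root_eq_1_iff[OF assms, of s]
    by (simp add: unity_root_of_nat_mult sum_gp_strict)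
qed

text \<open>Orthogonality: the sum over all \<open>c\<close> factors into one geometric sum per
  coordinate, so it detects whether the vector \<open>s\<close> vanishes modulo
  \<open>m\<close>.\<close>

lemma sum_characters:
  assumes "m > 0" "finite K"
  shows "(\<Sum>c\<in>K \<rightarrow>\<^sub>E {..<m}. unity_root m (\<Sum>k\<in>K. int (c k) * s k)) =
    (if \<forall>k\<in>K. int m dvd s k then of_nat m ^ card K else 0)"
proof -
  have "(\<Sum>c\<in>K \<rightarrow>\<^sub>E {..<m}. unity_root m (\<Sum>k\<in>K. int (c k) * s k)) =
      (\<Prod>k\<in>K. \<Sum>t<m. unity_root m (int t * s k))"
    unfolding unity_root_sum using assms by (subst prod_sum_PiE) simp_all
  also have "\<dots> = (\<Prod>k\<in>K. if int m dvd s k then of_nat m else 0)"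
    using assms by (simp add: sum_unity_root)
  also have "\<dots> = (if \<forall>k\<in>K. int m dvd s k then of_nat m ^ card K else 0)"
    using assms by auto
  finally show ?thesis .
qed

section \<open>Nonempty subsets with zero sum modulo \<open>m\<close>\<close>

text \<open>
  Choosing each value to be the one attained most often among the surviving elements
  of \<open>C\<close> shrinks the set of survivors by a factor \<open>1 - 1 / m\<close>.
\<close>

lemma greedy_hitting_values:
  fixes \<phi> :: "'c \<Rightarrow> 'i \<Rightarrow> nat"
  assumes "finite I" "finite C" and \<phi>: "\<And>c i. \<phi> c i < m"
  shows "\<exists>a. card {c\<in>C. \<forall>i\<in>I. \<phi> c i \<noteq> a i} * m ^ card I \<le> card C * (m - 1) ^ card I"
  using assms(1)
proof (induction I rule: finite_induct)
  case empty
  show ?case by simp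
next
  case (insert j I)
  then obtain a where
    a: "card {c\<in>C. \<forall>i\<in>I. \<phi> c i \<noteq> a i} * m ^ card I \<le> card C * (m - 1) ^ card I"
    by blast
  define R where "R = {c\<in>C. \<forall>i\<in>I. \<phi> c i \<noteq> a i}"
  have finR: "finite R" unfolding R_def using assms(2) by simp
  \<comment> \<open>Pigeonhole: the \<open>m\<close> possible values split \<open>R\<close> into
    classes, which cannot all have fewer than \<open>card R / m\<close> elements.\<close>
  have "\<exists>b<m. card R \<le> m * card {c\<in>R. \<phi> c j = b}"
  proof (rule ccontr)
    assume "\<not> ?thesis"
    then have less: "\<And>b. b < m \<Longrightarrow> m * card {c\<in>R. \<phi> c j = b} < card R"
      by (meson not_le)
    have "m > 0" using \<phi>[of undefined j] by simp
    have "R = (\<Union>b<m. {c\<in>R. \<phi> c j = b})" using \<phi> by auto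
    then have "card R = card (\<Union>b<m. {c\<in>R. \<phi> c j = b})" by simp
    also have "\<dots> = (\<Sum>b<m. card {c\<in>R. \<phi> c j = b})"
      by (rule card_UN_disjoint) (use finR in auto)
    finally have "m * card R = (\<Sum>b<m. m * card {c\<in>R. \<phi> c j = b})"
      by (simp add: sum_distrib_left)
    also have "\<dots> < (\<Sum>b<m. card R)"
      using less \<open>m > 0\<close> by (intro sum_strict_mono) auto
    finally show False by simp
  qed
  then obtain b where b: "card R \<le> m * card {c\<in>R. \<phi> c j = b}" by blast
  have "card R = card {c\<in>R. \<phi> c j = b} + card {c\<in>R. \<phi> c j \<noteq> b}"
    using finR by (subst card_Un_disjoint[symmetric]) (auto intro: arg_cong[where f = card])
  then have "m * card R = m * card {c\<in>R. \<phi> c j = b} + m * card {c\<in>R. \<phi> c j \<noteq> b}"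
    by (simp add: distrib_left)
  with b have step: "m * card {c\<in>R. \<phi> c j \<noteq> b} \<le> card R * (m - 1)"
    by (simp add: diff_mult_distrib2 mult.commute)
  have "{c\<in>C. \<forall>i\<in>insert j I. \<phi> c i \<noteq> (a(j := b)) i} = {c\<in>R. \<phi> c j \<noteq> b}"
    unfolding R_def using insert.hyps by auto
  then have "card {c\<in>C. \<forall>i\<in>insert j I. \<phi> c i \<noteq> (a(j := b)) i} * m ^ card (insert j I) =
      m * card {c\<in>R. \<phi> c j \<noteq> b} * m ^ card I"
    using insert.hyps by (simp add: mult.assoc mult.left_commute)
  also have "\<dots> \<le> card R * (m - 1) * m ^ card I"
    using step by (rule mult_right_mono) simp
  also have "\<dots> = card R * m ^ card I * (m - 1)"
    by simp
  also have "\<dots> \<le> card C * (m - 1) ^ card I * (m - 1)"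
    using a unfolding R_def by (rule mult_right_mono) simp
  also have "\<dots> = card C * (m - 1) ^ card (insert j I)"
    using insert.hyps by simp
  finally show ?case by blast
qed

text \<open>Of \<open>m ^ r\<close> characters, the fraction surviving \<open>N\<close> greedy
  choices is at most \<open>(1 - 1 / m) ^ N < exp (- N / m)\<close>, hence below
  \<open>1 / m ^ r\<close>: none survives. \<open>N > 0\<close> keeps this strict when
  \<open>r = 0\<close>.\<close>

lemma power_mult_pred_power_less:
  fixes m N r :: nat
  assumes "m > 1" "N > 0" "real N \<ge> real m * real r * ln (real m)"
  shows "m ^ r * (m - 1) ^ N < m ^ N"
proof -
  have "1 - 1 / real m < exp (- (1 / real m))"
    using exp_minus_greater[of "1 / real m"] assms(1) by simp
  then have "(1 - 1 / real m) ^ N < exp (- (1 / real m)) ^ N"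
    using assms by (intro power_strict_mono) auto
  also have "\<dots> = exp (- (real N / real m))"
    by (simp flip: exp_of_nat_mult)
  also have "\<dots> \<le> exp (- (real r * ln (real m)))"
    using assms by (simp add: field_simps)
  also have "\<dots> = 1 / real m ^ r"
    using assms by (simp add: exp_minus exp_of_nat_mult inverse_eq_divide)
  finally have "real m ^ r * ((1 - 1 / real m) ^ N * real m ^ N) < real m ^ N"
    using assms by (simp add: field_simps)
  moreover have "(1 - 1 / real m) ^ N * real m ^ N = real (m - 1) ^ N"
    using assms by (simp add: field_simps of_nat_diff flip: power_mult_distrib)
  ultimately have "real (m ^ r * (m - 1) ^ N) < real (m ^ N)"
    by simp
  then show ?thesis by (simp only: of_nat_less_iff)
qed

text \<open>A bound on the Davenport constant of the group of vectors modulo \<open>m\<close>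
  indexed by \<open>K\<close>; the vector of \<open>i\<close> has the entries
  \<open>w k i\<close>.\<close>

lemma exists_zero_sum_subset:
  fixes w :: "'k \<Rightarrow> 'i \<Rightarrow> int"
  assumes "m > 1" "finite I" "I \<noteq> {}" "finite K"
    and large: "real (card I) \<ge> real m * real (card K) * ln (real m)"
  shows "\<exists>J\<subseteq>I. J \<noteq> {} \<and> (\<forall>k\<in>K. int m dvd (\<Sum>i\<in>J. w k i))"
proof (rule ccontr)
  assume no: "\<not> ?thesis"
  define C where "C = K \<rightarrow>\<^sub>E {..<m}"
  \<comment> \<open>\<open>c\<close> encodes a character, and \<open>unity_root m (T c i)\<close> is
    its value on the vector of \<open>i\<close>. The \<open>a i\<close> chosen below are the
    exponents of the roots of unity \<alpha>_i.\<close>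
  define T where "T c i = (\<Sum>k\<in>K. int (c k) * w k i)" for c i
  have finC: "finite C" and cardC: "card C = m ^ card K"
    unfolding C_def using assms by (simp_all add: finite_PiE card_PiE)
  have "nat (T c i mod int m) < m" for c i
    using assms(1) by (simp add: nat_less_iff)
  then obtain a where
    a: "card {c\<in>C. \<forall>i\<in>I. nat (T c i mod int m) \<noteq> a i} * m ^ card I
      \<le> card C * (m - 1) ^ card I"
    using greedy_hitting_values[of I C "\<lambda>c i. nat (T c i mod int m)" m] assms finC by blast
  also have "\<dots> < 1 * m ^ card I"
    using power_mult_pred_power_less[of m "card I" "card K"] assms cardC
    by (simp add: card_gt_0_iff)
  finally have "card {c\<in>C. \<forall>i\<in>I. nat (T c i mod int m) \<noteq> a i} < 1"
    using mult_less_cancel2 by blast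
  then have "{c\<in>C. \<forall>i\<in>I. nat (T c i mod int m) \<noteq> a i} = {}"
    using finC by simp
  then have hit: "\<exists>i\<in>I. nat (T c i mod int m) = a i" if "c \<in> C" for c
    using that by blast
  have vanish: "(\<Prod>i\<in>I. - unity_root m (T c i - int (a i)) + 1) = 0" if c: "c \<in> C" for c
  proof -
    obtain i where i: "i \<in> I" "nat (T c i mod int m) = a i" using hit[OF c] by blast
    have "int (a i) = T c i mod int m" using i(2) assms(1) pos_mod_sign[of "int m" "T c i"] by linarith
    then have "int m dvd T c i - int (a i)" by (simp add: dvd_minus_mod)
    then have "unity_root m (T c i - int (a i)) = 1"
      using assms(1) by (simp add: unity_root_eq_1_iff)
    then show ?thesis using i(1) assms(2) by (intro prod_zero) auto
  qed
  \<comment> \<open>Each factor is kept as a sum \<open>- u + 1\<close>, so the product expands over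
    the sets \<open>J\<close> of positions contributing \<open>- u\<close>. Multiplicativity then
    gives the character value at the sum of the vectors over \<open>J\<close>.\<close>
  have expand: "(\<Prod>i\<in>I. - unity_root m (T c i - int (a i)) + 1) =
      (\<Sum>J\<in>Pow I. (-1) ^ card J * unity_root m (- (\<Sum>i\<in>J. int (a i))) *
        unity_root m (\<Sum>k\<in>K. int (c k) * (\<Sum>i\<in>J. w k i)))" for c
  proof -
    have "(\<Prod>i\<in>J. - unity_root m (T c i - int (a i))) =
        (-1) ^ card J * unity_root m (- (\<Sum>i\<in>J. int (a i))) *
          unity_root m (\<Sum>k\<in>K. int (c k) * (\<Sum>i\<in>J. w k i))" for J
    proof -
      have "(\<Sum>k\<in>K. int (c k) * (\<Sum>i\<in>J. w k i)) = (\<Sum>i\<in>J. T c i)"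
        unfolding T_def sum_distrib_left by (rule sum.swap)
      then show ?thesis
        by (simp add: prod_uminus flip: unity_root_sum unity_root_add)
          (simp add: sum_subtractf flip: unity_root_add)
    qed
    then show ?thesis
      by (simp add: prod_add[OF assms(2)] del: add_uminus_conv_diff uminus_add_conv_diff)
  qed
  have "0 = (\<Sum>c\<in>C. \<Prod>i\<in>I. - unity_root m (T c i - int (a i)) + 1)"
    using vanish by simp
  also have "\<dots> = (\<Sum>J\<in>Pow I. (-1) ^ card J * unity_root m (- (\<Sum>i\<in>J. int (a i))) *
      (\<Sum>c\<in>C. unity_root m (\<Sum>k\<in>K. int (c k) * (\<Sum>i\<in>J. w k i))))"
    unfolding expand by (subst sum.swap) (simp add: sum_distrib_left)
  \<comment> \<open>By orthogonality the inner sum vanishes unless the vectors over \<open>J\<close>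
    sum to zero; by \<open>no\<close> only \<open>J = {}\<close> remains, with coefficient
    1.\<close>
  also have "\<dots> = (\<Sum>J\<in>Pow I. if J = {} then of_nat m ^ card K else 0)"
    unfolding C_def using assms(1,4) no
    by (intro sum.cong refl) (auto simp: sum_characters)
  also have "\<dots> = of_nat m ^ card K"
    using assms(2) by simp
  finally show False using assms(1) by simp
qed

section \<open>Flipping coordinates of Boolean points\<close>

definition flip_on :: "nat set \<Rightarrow> (nat \<Rightarrow> int) \<Rightarrow> nat \<Rightarrow> int" where
  "flip_on J x = (\<lambda>i. if i \<in> J then 1 - x i else x i)"

lemma bool_cube_D: "x \<in> bool_cube n \<Longrightarrow> i < n \<Longrightarrow> x i = 0 \<or> x i = 1"
  unfolding bool_cube_def by (auto dest: PiE_mem)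

lemma bool_cube_undefined: "x \<in> bool_cube n \<Longrightarrow> \<not> i < n \<Longrightarrow> x i = undefined"
  unfolding bool_cube_def by (rule PiE_arb[of x "{..<n}"]) simp_all

lemma flip_on_in_bool_cube:
  assumes "x \<in> bool_cube n" "J \<subseteq> {..<n}"
  shows "flip_on J x \<in> bool_cube n"
proof (unfold bool_cube_def, rule PiE_I)
  fix i assume "i \<in> {..<n}"
  with assms(1) have "x i \<in> {0, 1}" unfolding bool_cube_def by (rule PiE_mem)
  then show "flip_on J x i \<in> {0, 1}" by (auto simp: flip_on_def)
next
  fix i assume "i \<notin> {..<n}"
  then have "i \<notin> J" "x i = undefined"
    using assms bool_cube_undefined by auto
  then show "flip_on J x i = undefined" by (simp add: flip_on_def)
qed

lemma flip_on_differences: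
  assumes "x \<in> bool_cube n" "y \<in> bool_cube n"
  shows "flip_on {i\<in>{..<n}. x i \<noteq> y i} y = x"
proof
  fix i
  show "flip_on {i\<in>{..<n}. x i \<noteq> y i} y i = x i"
  proof (cases "i < n")
    case True
    then show ?thesis
      using bool_cube_D[OF assms(1) True] bool_cube_D[OF assms(2) True]
      by (auto simp: flip_on_def)
  next
    case False
    then have "x i = undefined" "y i = undefined"
      using assms bool_cube_undefined by auto
    with False show ?thesis by (simp add: flip_on_def)
  qed
qed

lemma finite_bool_cube: "finite (bool_cube n)"
  unfolding bool_cube_def by (simp add: finite_PiE)

lemma card_bool_cube: "card (bool_cube n) = 2 ^ n"
  unfolding bool_cube_def by (simp add: card_PiE numeral_2_eq_2)

text \<open>A flip replaces \<open>x i\<close> by \<open>1 - x i\<close>, an increment of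
  \<open>1 - 2 * x i\<close>. These increments supply the vectors for the zero-sum argument.\<close>

lemma sum_flip_on:
  fixes w x :: "nat \<Rightarrow> int"
  assumes "J \<subseteq> {..<n}"
  shows "(\<Sum>i<n. w i * flip_on J x i) = (\<Sum>i<n. w i * x i) + (\<Sum>i\<in>J. (1 - 2 * x i) * w i)"
proof -
  have "(\<Sum>i\<in>J. (1 - 2 * x i) * w i) = (\<Sum>i<n. if i \<in> J then (1 - 2 * x i) * w i else 0)"
    using assms by (simp add: sum.If_cases inf_absorb2)
  then show ?thesis
    by (simp add: flip_on_def algebra_simps flip: sum.distrib)
      (rule sum.cong, auto simp: algebra_simps)
qed

section \<open>Boolean solutions of linear systems modulo \<open>m\<close>\<close>

definition linear_fibre ::
    "nat \<Rightarrow> nat \<Rightarrow> 'k set \<Rightarrow> ('k \<Rightarrow> nat \<Rightarrow> int) \<Rightarrow> (nat \<Rightarrow> int) \<Rightarrow> (nat \<Rightarrow> int) set" where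
  "linear_fibre m n K w z =
    {x \<in> bool_cube n. \<forall>k\<in>K. [\<Sum>i<n. w k i * x i = \<Sum>i<n. w k i * z i] (mod int m)}"

text \<open>A zero-sum set of increments leaves every form unchanged modulo \<open>m\<close>.
  Leaving \<open>I\<close> free allows flips confined to the positions where \<open>y\<close>
  differs from a target point.\<close>

lemma linear_fibre_flip:
  assumes "m > 1" "finite K" "y \<in> linear_fibre m n K w z" "I \<subseteq> {..<n}" "I \<noteq> {}"
    and "real (card I) \<ge> real m * real (card K) * ln (real m)"
  obtains J where "J \<subseteq> I" "J \<noteq> {}" "flip_on J y \<in> linear_fibre m n K w z"
proof -
  have "finite I" using assms(4) finite_subset by blast
  then obtain J where J: "J \<subseteq> I" "J \<noteq> {}"
    "\<And>k. k \<in> K \<Longrightarrow> int m dvd (\<Sum>i\<in>J. (1 - 2 * y i) * w k i)"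
    using exists_zero_sum_subset[of m I K "\<lambda>k i. (1 - 2 * y i) * w k i"] assms by metis
  have Jn: "J \<subseteq> {..<n}" using J(1) assms(4) by blast
  have "[\<Sum>i<n. w k i * flip_on J y i = \<Sum>i<n. w k i * z i] (mod int m)" if k: "k \<in> K" for k
  proof -
    have "[\<Sum>i<n. w k i * y i = \<Sum>i<n. w k i * z i] (mod int m)"
      using assms(3) k by (simp add: linear_fibre_def)
    moreover have "[\<Sum>i\<in>J. (1 - 2 * y i) * w k i = 0] (mod int m)"
      using J(3)[OF k] by (simp add: cong_0_iff)
    ultimately have "[(\<Sum>i<n. w k i * y i) + (\<Sum>i\<in>J. (1 - 2 * y i) * w k i) =
        (\<Sum>i<n. w k i * z i) + 0] (mod int m)"
      by (rule cong_add)
    then show ?thesis by (simp add: sum_flip_on[OF Jn])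
  qed
  then have "flip_on J y \<in> linear_fibre m n K w z"
    using assms(3) flip_on_in_bool_cube[OF _ Jn] by (auto simp: linear_fibre_def)
  with J show thesis using that by blast
qed

section \<open>Hamming balls and the size of a fibre\<close>

text \<open>Bounds the size of a Hamming ball of radius \<open>e\<close>; radius 1 fails because
  \<open>1 + n > n\<close>. In the induction from 2, the new binomial and \<open>n ^ e\<close> each
  take at most half of \<open>n ^ Suc e\<close>.\<close>

lemma sum_binomial_le_power:
  fixes n e :: nat
  assumes "n \<ge> 2" "e \<noteq> 1"
  shows "(\<Sum>k\<le>e. n choose k) \<le> n ^ e"
proof (cases "e = 0")
  case True
  then show ?thesis by simp
next
  case False
  with assms have "e \<ge> 2" by simp
  then show ?thesis
  proof (induction e rule: dec_induct)
    case base
    have "even (n * (n - 1))" by (cases n) auto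
    then have "n * (n - 1) = (n choose 2) * 2"
      unfolding choose_two by (rule dvd_div_mult_self[symmetric])
    moreover have "n * n = n * (n - 1) + n"
      using assms(1) by (cases n) auto
    moreover have "2 * n \<le> n * n" using assms(1) by simp
    moreover have "(\<Sum>k\<le>2. n choose k) = 1 + n + (n choose 2)"
      by (simp add: numeral_2_eq_2)
    ultimately show ?case
      using assms(1) unfolding power2_eq_square by linarith
  next
    case (step e)
    have "fact 2 \<le> (fact (Suc e) :: nat)"
      using step.hyps by (intro fact_mono) simp
    then have "(n choose Suc e) * 2 \<le> (n choose Suc e) * fact (Suc e)"
      by (intro mult_left_mono) simp_all
    also have "\<dots> \<le> n ^ Suc e" by (rule binomial_fact_pow)
    finally have "(n choose Suc e) * 2 \<le> n ^ Suc e" .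
    moreover have "2 * n ^ e \<le> n ^ Suc e" using assms(1) by simp
    ultimately have "n ^ e + (n choose Suc e) \<le> n ^ Suc e" by linarith
    with step.IH show ?case by simp
  qed
qed

lemma card_subsets_card_le:
  assumes "finite A"
  shows "card {J. J \<subseteq> A \<and> card J \<le> e} = (\<Sum>k\<le>e. card A choose k)"
proof -
  have "{J. J \<subseteq> A \<and> card J \<le> e} = (\<Union>k\<le>e. {J. J \<subseteq> A \<and> card J = k})"
    by auto
  also have "card \<dots> = (\<Sum>k\<le>e. card {J. J \<subseteq> A \<and> card J = k})"
    using assms by (intro card_UN_disjoint) auto
  finally show ?thesis using assms by (simp add: n_subsets)
qed

text \<open>Take \<open>y\<close> in the fibre closest to \<open>x\<close>. Were it farther away
  than the bound, flipping suitable differing positions would stay in the fibre and come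
  closer.\<close>

lemma linear_fibre_nearby:
  assumes "m > 1" "finite K" "z \<in> bool_cube n" "x \<in> bool_cube n"
  obtains y where "y \<in> linear_fibre m n K w z"
    "real (card {i\<in>{..<n}. x i \<noteq> y i}) \<le> real m * real (card K) * ln (real m)"
proof -
  define d where "d y = card {i\<in>{..<n}. x i \<noteq> y i}" for y :: "nat \<Rightarrow> int"
  have "z \<in> linear_fibre m n K w z" using assms(3) by (simp add: linear_fibre_def)
  then obtain y where y: "y \<in> linear_fibre m n K w z"
    and min: "\<And>y'. y' \<in> linear_fibre m n K w z \<Longrightarrow> d y \<le> d y'"
    using ex_has_least_nat[of "\<lambda>y. y \<in> linear_fibre m n K w z" z d] by blast
  have yc: "y \<in> bool_cube n" using y by (simp add: linear_fibre_def)
  have "real (d y) \<le> real m * real (card K) * ln (real m)"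
  proof (rule ccontr)
    assume far: "\<not> ?thesis"
    define I where "I = {i\<in>{..<n}. x i \<noteq> y i}"
    have "0 \<le> real m * real (card K) * ln (real m)" using assms(1) by simp
    with far have "d y > 0" by (cases "d y") auto
    then have "I \<noteq> {}" unfolding d_def I_def[symmetric] by (simp add: card_gt_0_iff)
    moreover have "I \<subseteq> {..<n}" unfolding I_def by blast
    moreover have "real (card I) \<ge> real m * real (card K) * ln (real m)"
      using far unfolding d_def I_def by simp
    ultimately obtain J where J: "J \<subseteq> I" "J \<noteq> {}" "flip_on J y \<in> linear_fibre m n K w z"
      using linear_fibre_flip[OF assms(1,2) y] by blast
    \<comment> \<open>Boolean entries that differ become equal after a flip, so all of the nonempty
      \<open>J\<close> leaves the difference set and nothing enters it.\<close>
    have "{i\<in>{..<n}. x i \<noteq> flip_on J y i} \<subset> I"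
    proof
      show "{i\<in>{..<n}. x i \<noteq> flip_on J y i} \<subseteq> I"
        using J(1) by (auto simp: I_def flip_on_def split: if_splits)
      obtain j where j: "j \<in> J" using J(2) by blast
      then have "j \<in> I" using J(1) by blast
      then have "x j = flip_on J y j"
        using j bool_cube_D[OF assms(4), of j] bool_cube_D[OF yc, of j]
        by (auto simp: I_def flip_on_def)
      with \<open>j \<in> I\<close> show "{i\<in>{..<n}. x i \<noteq> flip_on J y i} \<noteq> I" by blast
    qed
    then have "d (flip_on J y) < d y"
      unfolding d_def I_def by (intro psubset_card_mono) auto
    with min[OF J(3)] show False by simp
  qed
  with y show thesis using that unfolding d_def by blast
qed

text \<open>The Hamming balls of radius \<open>e\<close> around the fibre cover the cube, and each
  has at most \<open>n ^ e\<close> points.\<close>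

lemma power_2_le_card_linear_fibre:
  assumes "m > 1" "finite K" "z \<in> bool_cube n" "n \<ge> 2" "e \<noteq> 1"
    and e: "\<And>d. real d \<le> real m * real (card K) * ln (real m) \<Longrightarrow> d \<le> e"
  shows "2 ^ n \<le> card (linear_fibre m n K w z) * n ^ e"
proof -
  define S where "S = linear_fibre m n K w z"
  define P where "P = {J. J \<subseteq> {..<n} \<and> card J \<le> e}"
  have finS: "finite S"
    unfolding S_def linear_fibre_def using finite_bool_cube by simp
  have finP: "finite P" unfolding P_def by simp
  \<comment> \<open>Each point is recovered from a nearby fibre point and the set of positions where
    the two differ.\<close>
  have "bool_cube n \<subseteq> (\<lambda>(y, J). flip_on J y) ` (S \<times> P)"
  proof
    fix x assume x: "x \<in> bool_cube n"
    obtain y where y: "y \<in> S" "card {i\<in>{..<n}. x i \<noteq> y i} \<le> e"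
      using linear_fibre_nearby[OF assms(1-3) x] e unfolding S_def by metis
    have "y \<in> bool_cube n" using y(1) by (simp add: S_def linear_fibre_def)
    then have "x = flip_on {i\<in>{..<n}. x i \<noteq> y i} y"
      using flip_on_differences x by simp
    moreover have "{i\<in>{..<n}. x i \<noteq> y i} \<in> P" using y(2) by (auto simp: P_def)
    ultimately show "x \<in> (\<lambda>(y, J). flip_on J y) ` (S \<times> P)"
      using y(1) by (intro image_eqI[of _ _ "(y, {i\<in>{..<n}. x i \<noteq> y i})"]) simp_all
  qed
  then have "card (bool_cube n) \<le> card ((\<lambda>(y, J). flip_on J y) ` (S \<times> P))"
    using finS finP by (intro card_mono) auto
  also have "\<dots> \<le> card (S \<times> P)"
    using finS finP by (intro card_image_le) auto
  also have "\<dots> = card S * card P" by (rule card_cartesian_product)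
  also have "\<dots> \<le> card S * n ^ e"
    using sum_binomial_le_power[OF assms(4,5)]
    by (simp add: P_def card_subsets_card_le)
  finally show ?thesis by (simp add: card_bool_cube S_def)
qed

text \<open>Flip \<open>z\<close> within the set of all coordinates; \<open>n \<ge> 1\<close> makes
  that set nonempty even when \<open>K\<close> is empty.\<close>

lemma two_le_card_linear_fibre:
  assumes "m > 1" "finite K" "z \<in> bool_cube n" "n \<ge> 1"
    and "real n \<ge> real m * real (card K) * ln (real m)"
  shows "card (linear_fibre m n K w z) \<ge> 2"
proof -
  have z: "z \<in> linear_fibre m n K w z" using assms(3) by (simp add: linear_fibre_def)
  have "0 \<in> {..<n}" using assms(4) by simp
  then have "{..<n} \<noteq> {}" by blast
  then obtain J where J: "J \<subseteq> {..<n}" "J \<noteq> {}" "flip_on J z \<in> linear_fibre m n K w z"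
    using linear_fibre_flip[OF assms(1,2) z subset_refl] assms(5) unfolding card_lessThan by blast
  obtain j where "j \<in> J" using J by blast
  \<comment> \<open>Equality would make 1 equal to the even number \<open>2 * z j\<close>.\<close>
  moreover have "1 - z j \<noteq> z j" by presburger
  ultimately have "flip_on J z j \<noteq> z j" by (simp add: flip_on_def)
  then have "flip_on J z \<noteq> z" by metis
  then have "card {z, flip_on J z} = 2" by simp
  moreover have "finite (linear_fibre m n K w z)"
    unfolding linear_fibre_def using finite_bool_cube by simp
  ultimately show ?thesis
    using card_mono[of "linear_fibre m n K w z" "{z, flip_on J z}"] z J(3) by auto
qed

section \<open>From boolean rank to one linear system modulo \<open>m\<close>\<close>

text \<open>The coordinate forms represent any polynomial, so the minimum is attained.\<close>

lemma boolean_rank_attained: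
  assumes "q > 1"
  shows "\<exists>(F :: int list \<Rightarrow> int) (v :: nat \<Rightarrow> nat \<Rightarrow> int). \<forall>x\<in>bool_cube n.
    [eval_poly f x = F (map (\<lambda>j. (\<Sum>i<n. v j i * x i) mod int q) [0..<boolean_rank q n f])]
      (mod int q)"
  unfolding boolean_rank_def
proof (rule LeastI[where k = n])
  \<comment> \<open>Points of the cube are \<open>undefined\<close> outside \<open>{..<n}\<close>,
    so with this default the list of coordinates gives back \<open>x\<close> itself.\<close>
  define F where "F l = eval_poly f (\<lambda>i. if i < n then l ! i else undefined)" for l
  define v :: "nat \<Rightarrow> nat \<Rightarrow> int" where "v j i = (if i = j then 1 else 0)" for i j
  have "[eval_poly f x = F (map (\<lambda>j. (\<Sum>i<n. v j i * x i) mod int q) [0..<n])] (mod int q)"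
    if x: "x \<in> bool_cube n" for x
  proof -
    have entry: "(\<Sum>i<n. v j i * x i) mod int q = x j" if "j < n" for j
    proof -
      have "(\<Sum>i<n. v j i * x i) = (\<Sum>i<n. if i = j then x i else 0)"
        by (intro sum.cong) (auto simp: v_def)
      also have "\<dots> = x j" using that by simp
      finally show ?thesis using bool_cube_D[OF x that] assms by auto
    qed
    have "map (\<lambda>j. (\<Sum>i<n. v j i * x i) mod int q) [0..<n] = map x [0..<n]"
      using entry by (intro map_cong) simp_all
    moreover have "(\<lambda>i. if i < n then map x [0..<n] ! i else undefined) = x"
      by (rule ext) (simp add: bool_cube_undefined[OF x])
    ultimately show ?thesis unfolding F_def by (simp only: cong_refl)
  qed
  then show "\<exists>(F :: int list \<Rightarrow> int) (v :: nat \<Rightarrow> nat \<Rightarrow> int). \<forall>x\<in>bool_cube n.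
      [eval_poly f x = F (map (\<lambda>j. (\<Sum>i<n. v j i * x i) mod int q) [0..<n])] (mod int q)"
    by blast
qed

lemma finite_exact_prime_powers:
  assumes "m > 0"
  shows "finite (exact_prime_powers m)"
  by (rule finite_subset[of _ "{d. d dvd m}"]) (use assms in \<open>auto simp: exact_prime_powers_def\<close>)

lemma exact_prime_powers_gt_1: "q \<in> exact_prime_powers m \<Longrightarrow> q > 1"
  unfolding exact_prime_powers_def
  by (auto dest!: prime_gt_1_nat simp: one_less_power simp del: One_nat_def)

lemma exact_prime_powers_dvd: "q \<in> exact_prime_powers m \<Longrightarrow> q dvd m"
  by (auto simp: exact_prime_powers_def)

text \<open>Compare multiplicities prime by prime: for each prime \<open>p\<close> dividing
  \<open>m\<close>, the power \<open>p ^ multiplicity p m\<close> is among the exact prime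
  powers.\<close>

lemma dvd_if_exact_prime_powers_dvd:
  assumes "m > 0" "\<And>q. q \<in> exact_prime_powers m \<Longrightarrow> q dvd N"
  shows "m dvd N"
proof (cases "N = 0")
  case False
  show ?thesis
  proof (rule multiplicity_le_imp_dvd)
    fix p :: nat assume p: "prime p"
    show "multiplicity p m \<le> multiplicity p N"
    proof (cases "multiplicity p m = 0")
      case False
      have "\<not> is_unit p" using p by auto
      then have "p ^ multiplicity p m \<in> exact_prime_powers m"
        unfolding exact_prime_powers_def mem_Collect_eq using p False assms(1)
        by (intro exI[of _ p] exI[of _ "multiplicity p m"] conjI)
          (auto simp: multiplicity_dvd power_dvd_iff_le_multiplicity simp del: power_Suc)
      then have "p ^ multiplicity p m dvd N" by (rule assms(2))
      with \<open>N \<noteq> 0\<close> \<open>\<not> is_unit p\<close> show ?thesis by (intro multiplicity_geI) auto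
    qed simp
  qed (use assms in simp)
qed simp

text \<open>
  Multiplying a form modulo \<open>q\<close> by \<open>m div q\<close> turns a congruence modulo \<open>q\<close> into one modulo
  \<open>m\<close>, so that all forms can be taken over the same modulus.
\<close>

lemma linear_fibre_subset_bool_solutions:
  assumes "m > 1" and z: "z \<in> bool_cube n" "[eval_poly f z = 0] (mod int m)"
  defines "K \<equiv> Sigma (exact_prime_powers m) (\<lambda>q. {..<boolean_rank q n f})"
  obtains w :: "nat \<times> nat \<Rightarrow> nat \<Rightarrow> int"
  where "linear_fibre m n K w z \<subseteq> bool_solutions m n f"
proof -
  have "\<forall>q\<in>exact_prime_powers m. \<exists>(F :: int list \<Rightarrow> int) v. \<forall>x\<in>bool_cube n.
      [eval_poly f x = F (map (\<lambda>j. (\<Sum>i<n. v j i * x i) mod int q) [0..<boolean_rank q n f])]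
        (mod int q)"
    using boolean_rank_attained exact_prime_powers_gt_1 by blast
  from bchoice[OF this] obtain F :: "nat \<Rightarrow> int list \<Rightarrow> int" where
    "\<forall>q\<in>exact_prime_powers m. \<exists>v. \<forall>x\<in>bool_cube n.
      [eval_poly f x = F q (map (\<lambda>j. (\<Sum>i<n. v j i * x i) mod int q) [0..<boolean_rank q n f])]
        (mod int q)" ..
  from bchoice[OF this] obtain v :: "nat \<Rightarrow> nat \<Rightarrow> nat \<Rightarrow> int" where
    "\<forall>q\<in>exact_prime_powers m. \<forall>x\<in>bool_cube n.
      [eval_poly f x = F q (map (\<lambda>j. (\<Sum>i<n. v q j i * x i) mod int q) [0..<boolean_rank q n f])]
        (mod int q)" ..
  then have Fv: "\<And>q x. q \<in> exact_prime_powers m \<Longrightarrow> x \<in> bool_cube n \<Longrightarrow>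
      [eval_poly f x = F q (map (\<lambda>j. (\<Sum>i<n. v q j i * x i) mod int q) [0..<boolean_rank q n f])]
        (mod int q)"
    by blast
  define w where "w = (\<lambda>(q, j) i. int (m div q) * v q j i)"
  have "linear_fibre m n K w z \<subseteq> bool_solutions m n f"
  proof
    fix x assume x: "x \<in> linear_fibre m n K w z"
    then have xc: "x \<in> bool_cube n" by (simp add: linear_fibre_def)
    have "int q dvd eval_poly f x" if q: "q \<in> exact_prime_powers m" for q
    proof -
      obtain c where c: "m = q * c" using exact_prime_powers_dvd[OF q] by (elim dvdE)
      with assms(1) have cpos: "c > 0" "q > 0" by (auto intro: Nat.gr0I)
      have "(\<Sum>i<n. v q j i * x i) mod int q = (\<Sum>i<n. v q j i * z i) mod int q"
        if j: "j < boolean_rank q n f" for j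
      proof -
        have "(q, j) \<in> K" using q j by (simp add: K_def)
        then have "[\<Sum>i<n. w (q, j) i * x i = \<Sum>i<n. w (q, j) i * z i] (mod int m)"
          using x by (simp add: linear_fibre_def)
        moreover have "(\<Sum>i<n. w (q, j) i * u i) = int c * (\<Sum>i<n. v q j i * u i)" for u
          using c cpos by (simp add: w_def sum_distrib_left mult.assoc)
        \<comment> \<open>The weight \<open>m div q = c\<close> is a common factor; cancelling it
          turns the modulus \<open>m\<close> back into \<open>q\<close>.\<close>
        ultimately have "int c * int q dvd int c * ((\<Sum>i<n. v q j i * x i) - (\<Sum>i<n. v q j i * z i))"
          using c by (simp add: cong_iff_dvd_diff right_diff_distrib mult.commute)
        then have "int q dvd (\<Sum>i<n. v q j i * x i) - (\<Sum>i<n. v q j i * z i)"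
          using cpos by simp
        then show ?thesis by (simp add: mod_eq_dvd_iff)
      qed
      then have same: "map (\<lambda>j. (\<Sum>i<n. v q j i * x i) mod int q) [0..<boolean_rank q n f] =
          map (\<lambda>j. (\<Sum>i<n. v q j i * z i) mod int q) [0..<boolean_rank q n f]"
        by simp
      have "[eval_poly f x = eval_poly f z] (mod int q)"
        using Fv[OF q xc] Fv[OF q z(1)] unfolding same
        by (meson cong_sym cong_trans)
      moreover have "[eval_poly f z = 0] (mod int q)"
        using z(2) c by (metis cong_0_iff dvd_trans dvd_triv_left of_nat_mult)
      ultimately show ?thesis by (meson cong_0_iff cong_trans)
    qed
    then have dvd: "q dvd nat \<bar>eval_poly f x\<bar>" if "q \<in> exact_prime_powers m" for q
      using that by (simp only: dvd_nat_abs_iff)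
    have "m dvd nat \<bar>eval_poly f x\<bar>"
      by (rule dvd_if_exact_prime_powers_dvd[OF _ dvd]) (use assms(1) in simp)
    then have "int m dvd eval_poly f x" by (simp only: dvd_nat_abs_iff)
    then show "x \<in> bool_solutions m n f"
      using xc by (simp add: bool_solutions_def cong_0_iff)
  qed
  then show thesis using that by blast
qed

section \<open>Bounds on the number of Boolean zeros\<close>

theorem theorem3p2:
  fixes m n r :: nat and f :: mpolynomial
  assumes "m > 1"
    and "f \<in> polys_mod m n"
    and "degree_at_most 2 f"
    and "r = (\<Sum>q\<in>exact_prime_powers m. boolean_rank q n f)"
    and "\<exists>x\<in>bool_cube n. [eval_poly f x = 0] (mod int m)"
  shows "(n \<ge> 1 \<longrightarrow> real n \<ge> real m * real r * log 2 (real m) \<longrightarrow>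
            card (bool_solutions m n f) \<ge> 2) \<and>
         (n \<ge> 2 \<longrightarrow>
            real (card (bool_solutions m n f))
              \<ge> 2 powr (real n - real m * real r * log 2 (real m) * log 2 (real n)))"
proof -
  \<comment> \<open>One index per form and prime power, so that \<open>card K\<close> is
    \<open>r\<close>.\<close>
  define K where "K = Sigma (exact_prime_powers m) (\<lambda>q. {..<boolean_rank q n f})"
  have finQ: "finite (exact_prime_powers m)"
    using assms(1) by (intro finite_exact_prime_powers) simp
  then have finK: "finite K" and cardK: "card K = r"
    unfolding K_def assms(4) by (simp_all add: card_SigmaI)
  obtain z where z: "z \<in> bool_cube n" "[eval_poly f z = 0] (mod int m)"
    using assms(5) by blast
  then obtain w where w: "linear_fibre m n K w z \<subseteq> bool_solutions m n f"
    using linear_fibre_subset_bool_solutions[OF assms(1)] unfolding K_def by blast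
  have "finite (bool_solutions m n f)"
    unfolding bool_solutions_def using finite_bool_cube by simp
  with w have fibre_le: "card (linear_fibre m n K w z) \<le> card (bool_solutions m n f)"
    by (intro card_mono)
  define M where "M = real m * real r * log 2 (real m)"
  \<comment> \<open>The fibre bounds use natural logarithms; \<open>ln 2 \<le> 1\<close> makes them
    at most the binary ones in \<open>M\<close>.\<close>
  have "ln 2 \<le> (1 :: real)" using ln_le_minus_one[of "2 :: real"] by simp
  then have "ln (real m) * ln 2 \<le> ln (real m)"
    using assms(1) mult_left_mono[of "ln 2" 1 "ln (real m)"] by simp
  then have "ln (real m) \<le> log 2 (real m)"
    by (simp add: log_def field_simps)
  then have M: "real m * real (card K) * ln (real m) \<le> M"
    unfolding M_def cardK by (intro mult_left_mono) simp_all
  have "card (bool_solutions m n f) \<ge> 2" if "n \<ge> 1" "real n \<ge> M"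
    using two_le_card_linear_fibre[OF assms(1) finK z(1) that(1), of w] that(2) M fibre_le
    by linarith
  moreover have "real (card (bool_solutions m n f)) \<ge> 2 powr (real n - M * log 2 (real n))"
    if n: "n \<ge> 2"
  proof -
    define e where "e = nat \<lfloor>M\<rfloor>"
    have log_ge: "1 \<le> log 2 (real m)" using assms(1) by simp
    have M0: "M \<ge> 0" unfolding M_def using log_ge by simp
    \<comment> \<open>\<open>M\<close> is 0 if \<open>r = 0\<close> and at least 2 otherwise, since
      \<open>m \<ge> 2\<close>; its floor thus avoids the radius excluded from the ball
      estimate.\<close>
    have "e \<noteq> 1"
    proof (cases "r = 0")
      case False
      have "2 * 1 * 1 \<le> M"
        unfolding M_def using assms(1) False log_ge by (intro mult_mono) auto
      then show ?thesis unfolding e_def by linarith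
    qed (simp add: e_def M_def)
    moreover have "d \<le> e" if "real d \<le> real m * real (card K) * ln (real m)" for d
      using that M unfolding e_def by (simp add: le_nat_iff le_floor_iff)
    ultimately have "2 ^ n \<le> card (linear_fibre m n K w z) * n ^ e"
      using power_2_le_card_linear_fibre[OF assms(1) finK z(1) n] by blast
    also have "\<dots> \<le> card (bool_solutions m n f) * n ^ e"
      using fibre_le by simp
    finally have "real (2 ^ n) \<le> real (card (bool_solutions m n f) * n ^ e)"
      by (simp only: of_nat_le_iff)
    also have "\<dots> = real (card (bool_solutions m n f)) * real n powr real e"
      using n by (simp add: powr_realpow)
    also have "\<dots> \<le> real (card (bool_solutions m n f)) * real n powr M"
      using n M0 by (intro mult_left_mono powr_mono) (auto simp: e_def)
    also have "real n powr M = 2 powr (M * log 2 (real n))"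
      using n powr_powr[of 2 "log 2 (real n)" M] by (simp add: mult.commute)
    finally show ?thesis
      by (simp add: powr_diff powr_realpow field_simps)
  qed
  ultimately show ?thesis unfolding M_def by blast
qed

end
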